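(* There exists an absolute constant $C>0$ such that the following holds. Let $u$ be a linear operator on $\ell_2^N$ with $\|u\|=1$, and let $M=\max_{1\le j\le N}\|ue_j\|$. Let $n$ be an integer with $1<n\le N$, and let $\sigma$ be a random subset of $\{1,\dots,N\}$ of cardinal $|\sigma|\sim n$, i.e. each element of $\{1,\dots,N\}$ is included in $\sigma$ independently with probability $n/N$. Then $$\mathbb{E}\,\big\|u|_{\mathbb{R}^\sigma}\big\|\le C\sqrt{\log n}\,\Big(\sqrt{\frac{n}{N}}+\sqrt{\log n}\;M\Big).$$
   Context: $\ell_2^N$ is $\mathbb{R}^N$ with the Euclidean norm and canonical basis $e_1,\dots,e_N$. For $\sigma\subset\{1,\dots,N\}$, $\mathbb{R}^\sigma$ is the coordinate subspace spanned by $\{e_j: j\in\sigma\}$, and $u|_{\mathbb{R}^\sigma}$ is the restriction of $u$ to it (its norm is $0$ if $\sigma=\emptyset$). $\|\cdot\|$ denotes the Euclidean norm of vectors and the operator norm of operators. *)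

theory Defs
  imports
    "HOL-Probability.Probability"
    "Jordan_Normal_Form.VS_Connect"
begin

text \<open>
  The dimension \<open>N\<close> is quantified inside the statement (the constant must not depend on it),
  so \<open>\<real>\<^sup>N\<close> is the carrier \<^term>\<open>carrier_vec N\<close> of vectors of length \<open>N\<close> rather than a type.
  Coordinates are numbered \<open>0, \<dots>, N - 1\<close>.
\<close>

abbreviation
  "ell2 N \<equiv> module_vec TYPE(real) N"

definition eucl_norm :: "real vec \<Rightarrow> real" where
  "eucl_norm v = sqrt (scalar_prod v v)"

text \<open>
  On a subspace \<open>S\<close> this is the operator norm of the restriction of \<open>u\<close> to \<open>S\<close>.
  For linear \<open>u\<close> the set of values is bounded, since the dimension is finite, and contains \<open>0\<close>;
  on the zero subspace the value is \<open>0\<close>.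
\<close>
definition op_norm_on :: "real vec set \<Rightarrow> (real vec \<Rightarrow> real vec) \<Rightarrow> real" where
  "op_norm_on S u = Sup {eucl_norm (u x) | x. x \<in> S \<and> eucl_norm x \<le> 1}"

abbreviation op_norm :: "nat \<Rightarrow> (real vec \<Rightarrow> real vec) \<Rightarrow> real" where
  "op_norm N u \<equiv> op_norm_on (carrier_vec N) u"

definition coord_subspace :: "nat \<Rightarrow> nat set \<Rightarrow> real vec set" where
  "coord_subspace N \<sigma> = LinearCombinations.module.span class_ring (ell2 N) (unit_vec N ` \<sigma>)"

text \<open>Law of the random subset of \<open>{..<N}\<close> with independent inclusions of probability \<open>p\<close>.\<close>
definition random_subset_pmf :: "nat \<Rightarrow> real \<Rightarrow> nat set pmf" where
  "random_subset_pmf N p =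
     map_pmf (\<lambda>\<delta>. {j \<in> {..<N}. \<delta> j}) (Pi_pmf {..<N} False (\<lambda>_. bernoulli_pmf p))"

end

theory Submission
  imports Defs
begin

text \<open>
  Write \<open>v\<^sub>j = u e\<^sub>j\<close>, \<open>p = n / N\<close>, and let \<open>S\<^sub>\<sigma> x = \<Sum>j\<in>\<sigma>. \<langle>v\<^sub>j, x\<rangle> v\<^sub>j\<close>, which is
  the positive operator \<open>w w\<^sup>T\<close> for \<open>w\<close> the restriction of \<open>u\<close> to \<open>\<real>\<^sup>\<sigma>\<close>. The norm of \<open>w\<close> to the power
  \<open>2q\<close> is at most the trace of \<open>S\<^sub>\<sigma>\<^sup>q\<close>, and the proof bounds the expectation of this trace for
  \<open>q\<close> about \<open>ln n\<close>, by induction on the exponent.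
  
  The trace of \<open>S\<^sub>\<sigma>\<^bsup>m+1\<^esup>\<close> is the sum of \<open>\<langle>S\<^sub>\<sigma>\<^sup>m v\<^sub>j, v\<^sub>j\<rangle>\<close> over \<open>j \<in> \<sigma>\<close>. Since the event
  \<open>j \<in> \<sigma>\<close> is independent of \<open>\<sigma> - {j}\<close>, its expectation is \<open>p\<close> times the sum over \<^emph>\<open>all\<close> \<open>j\<close> of the
  expectation of \<open>\<langle>(A + v\<^sub>j v\<^sub>j\<^sup>T)\<^sup>m v\<^sub>j, v\<^sub>j\<rangle>\<close>, where \<open>A\<close> belongs to \<open>\<sigma> - {j}\<close>. The rank-one perturbation is
  harmless: the moments \<open>c\<^sub>k = \<langle>A\<^sup>k v\<^sub>j, v\<^sub>j\<rangle>\<close> are log-convex, and expanding the power expresses the perturbed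
  moments through them by a renewal recursion, which yields the bound
  \<open>3 c\<^sub>m + 3 x (m x)\<^sup>m\<close> with \<open>x = \<parallel>v\<^sub>j\<parallel>\<^sup>2 \<le> M\<^sup>2\<close> (\<open>renewal_bound\<close>). Finally, as \<open>u u\<^sup>T \<le> 1\<close>, summing
  \<open>\<langle>S\<^sub>\<sigma>\<^sup>m v\<^sub>j, v\<^sub>j\<rangle>\<close> over all \<open>j\<close> gives at most the trace of \<open>S\<^sub>\<sigma>\<^sup>m\<close>
  (\<open>sum_power_form_le_trace_form\<close>). So the expected trace \<open>T\<^sub>m\<close> of \<open>S\<^sub>\<sigma>\<^sup>m\<close> satisfies
  \<open>T\<^bsub>m+1\<^esub> \<le> 3 p T\<^sub>m + 3 (m M\<^sup>2)\<^sup>m n M\<^sup>2\<close> and \<open>T\<^sub>1 \<le> n M\<^sup>2\<close>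
  (\<open>expec_trace_form_Suc_le\<close>, \<open>expec_trace_form_0_le\<close>).
  
  Hence \<open>T\<^sub>q \<le> q n K\<^sup>q\<close> with \<open>K = 3 (p + q M\<^sup>2)\<close>. The number of columns enters only through the
  factor \<open>p N = n\<close>, and for \<open>q \<ge> ln n\<close> its \<open>q\<close>-th root is bounded; this is why \<open>ln n\<close> and not \<open>ln N\<close> appears.
  It follows that the expected norm is at most a constant times \<open>sqrt p + sqrt q * M\<close>, which is smaller than the
  claimed bound by a factor of order \<open>sqrt (ln n)\<close>.
\<close>

section \<open>Log-convex sequences and a renewal recursion\<close>

text \<open>
  The ratios of consecutive terms increase, so a lower bound on one of them persists.
\<close>
lemma log_convex_ratio:
  fixes c :: "nat \<Rightarrow> real"
  assumes nonneg: "\<And>k. 0 \<le> c k"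
    and log_convex: "\<And>k. (c (Suc k))\<^sup>2 \<le> c k * c (Suc (Suc k))"
    and "0 \<le> r" and start: "r * c k \<le> c (Suc k)"
  shows "r * c (k + i) \<le> c (Suc (k + i))" and "r ^ i * c k \<le> c (k + i)"
proof -
  have ratio: "r * c (k + i) \<le> c (Suc (k + i))" for i
  proof (induction i)
    case 0
    show ?case using start by simp
  next
    case (Suc i)
    let ?a = "c (k + i)" and ?b = "c (Suc (k + i))" and ?d = "c (Suc (Suc (k + i)))"
    show ?case
    proof (cases "?b = 0")
      case True
      then show ?thesis using nonneg by simp
    next
      case False
      then have b: "?b > 0" using nonneg[of "Suc (k + i)"] by linarith
      have "?b * (r * ?b) = r * ?b\<^sup>2" by (simp add: power2_eq_square)
      also have "\<dots> \<le> r * (?a * ?d)" using log_convex \<open>0 \<le> r\<close> by (rule mult_left_mono)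
      also have "\<dots> = (r * ?a) * ?d" by simp
      also have "\<dots> \<le> ?b * ?d" using Suc nonneg by (intro mult_right_mono)
      finally show ?thesis using b by simp
    qed
  qed
  show "r * c (k + i) \<le> c (Suc (k + i))" by (rule ratio)
  show "r ^ i * c k \<le> c (k + i)"
  proof (induction i)
    case (Suc i)
    have "r ^ Suc i * c k = r * (r ^ i * c k)" by simp
    also have "\<dots> \<le> r * c (k + i)" using Suc \<open>0 \<le> r\<close> by (rule mult_left_mono)
    also have "\<dots> \<le> c (k + Suc i)" using ratio by simp
    finally show ?case .
  qed simp
qed

text \<open>
  A log-convex sequence lies below any geometric sequence that dominates it at both ends of an interval.
\<close>
lemma log_convex_geometric_bound:
  fixes c :: "nat \<Rightarrow> real"
  assumes nonneg: "\<And>k. 0 \<le> c k"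
    and log_convex: "\<And>k. (c (Suc k))\<^sup>2 \<le> c k * c (Suc (Suc k))"
    and L: "0 < L" and ends: "c 0 \<le> x" "c m \<le> x * L ^ m" and "k \<le> m"
  shows "c k \<le> x * L ^ k"
  using \<open>k \<le> m\<close>
proof (induction k)
  case 0
  show ?case using ends by simp
next
  case (Suc k)
  show ?case
  proof (cases "L * c k \<le> c (Suc k)")
    case True
    \<comment> \<open>All later ratios are at least \<open>L\<close> too, so an excess at \<open>Suc k\<close> would persist up to \<open>m\<close>.\<close>
    have "L * c (Suc k) \<le> c (Suc (Suc k))"
      using log_convex_ratio(1)[where c = c and i = 1, OF nonneg log_convex _ True] L by simp
    then have "L ^ (m - Suc k) * c (Suc k) \<le> c (Suc k + (m - Suc k))"
      using L by (intro log_convex_ratio(2) nonneg log_convex) auto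
    also have "\<dots> \<le> x * L ^ (Suc k + (m - Suc k))" using Suc.prems ends by simp
    also have "\<dots> = L ^ (m - Suc k) * (x * L ^ Suc k)" by (simp add: power_add)
    finally show ?thesis using L by (simp del: power_Suc)
  next
    case False
    then have "c (Suc k) \<le> L * c k" by simp
    also have "\<dots> \<le> L * (x * L ^ k)" using Suc L by (intro mult_left_mono) auto
    finally show ?thesis by (simp add: mult_ac)
  qed
qed

text \<open>
  If \<open>c\<^sub>k = x L\<^sup>k\<close> exactly, then \<open>x (L + x)\<^sup>m\<close> is the solution of the recursion; all terms being
  nonnegative, an upper bound on \<open>c\<close> propagates to \<open>d\<close>.
\<close>
lemma renewal_geometric_bound:
  fixes c d :: "nat \<Rightarrow> real"
  assumes renewal: "\<And>m. d m = c m + (\<Sum>k<m. c k * d (m - Suc k))"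
    and "0 \<le> x" "0 \<le> L"
    and nonneg: "\<And>k. 0 \<le> c k" and bound: "\<And>k. k \<le> m \<Longrightarrow> c k \<le> x * L ^ k"
  shows "d m \<le> x * (L + x) ^ m"
proof -
  have "k \<le> m \<Longrightarrow> d k \<le> x * (L + x) ^ k" for k
  proof (induction k rule: less_induct)
    case (less k)
    have "d k \<le> x * L ^ k + (\<Sum>i<k. (x * L ^ i) * (x * (L + x) ^ (k - Suc i)))"
      unfolding renewal[of k]
    proof (intro add_mono sum_mono)
      show "c k \<le> x * L ^ k" using bound less.prems .
      fix i assume i: "i \<in> {..<k}"
      have "c i * d (k - Suc i) \<le> c i * (x * (L + x) ^ (k - Suc i))"
        using i less by (intro mult_left_mono nonneg less.IH) auto
      also have "\<dots> \<le> (x * L ^ i) * (x * (L + x) ^ (k - Suc i))"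
        using i less.prems \<open>0 \<le> x\<close> \<open>0 \<le> L\<close> by (intro mult_right_mono bound) auto
      finally show "c i * d (k - Suc i) \<le> (x * L ^ i) * (x * (L + x) ^ (k - Suc i))" .
    qed
    also have "(\<Sum>i<k. (x * L ^ i) * (x * (L + x) ^ (k - Suc i)))
        = x * ((L + x - L) * (\<Sum>i<k. (L + x) ^ (k - Suc i) * L ^ i))"
      by (simp add: sum_distrib_left mult_ac)
    also have "\<dots> = x * ((L + x) ^ k - L ^ k)"
    proof -
      have "(L + x - L) * (\<Sum>i<k. (L + x) ^ (k - Suc i) * L ^ i) = (L + x) ^ k - L ^ k"
        using power_diff_sumr2[of L k "L + x"] by (simp add: algebra_simps)
      then show ?thesis by (rule arg_cong)
    qed
    finally show ?case by (simp add: algebra_simps)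
  qed
  then show ?thesis by simp
qed

text \<open>
  With \<open>x = c\<^sub>0\<close> and \<open>L\<close> the \<open>m\<close>-th root of \<open>c\<^sub>m / x\<close>, the geometric bound applies and gives
  \<open>d\<^sub>m \<le> x (L + x)\<^sup>m\<close>. Raising \<open>L\<close> to at least \<open>m x\<close> makes \<open>L + x \<le> L (1 + 1/m)\<close>, so that the
  perturbation costs only the factor \<open>(1 + 1/m)\<^sup>m \<le> 3\<close>.
\<close>
lemma renewal_bound:
  fixes c d :: "nat \<Rightarrow> real"
  assumes nonneg: "\<And>k. 0 \<le> c k"
    and log_convex: "\<And>k. (c (Suc k))\<^sup>2 \<le> c k * c (Suc (Suc k))"
    and renewal: "\<And>m. d m = c m + (\<Sum>k<m. c k * d (m - Suc k))"
    and m: "0 < m"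
  shows "d m \<le> 3 * c m + 3 * c 0 * (m * c 0) ^ m"
proof (cases "c 0 = 0")
  case True
  have "c k = 0" for k
  proof (induction k)
    case (Suc k)
    then show ?case using log_convex[of k] by simp
  qed (rule True)
  then show ?thesis using renewal[of m] True m by simp
next
  case False
  define x where "x = c 0"
  define L where "L = max (root m (c m / x)) (m * x)"
  have x: "0 < x" using False nonneg[of 0] unfolding x_def by linarith
  have "0 < real m * x" using x m by simp
  then have L: "0 < L" unfolding L_def by linarith
  have root_pow: "root m (c m / x) ^ m = c m / x"
    using m x nonneg by simp
  have root_nn: "0 \<le> root m (c m / x)"
    using x nonneg by (simp add: real_root_ge_zero)
  have "root m (c m / x) ^ m \<le> L ^ m"
    unfolding L_def using root_nn by (intro power_mono) auto
  then have "c m \<le> x * L ^ m" using root_pow x by (simp add: field_simps)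
  then have "d m \<le> x * (L + x) ^ m"
    using log_convex_geometric_bound[where c = c and m = m, OF nonneg log_convex L] x L
    by (intro renewal_geometric_bound[OF renewal] nonneg) (auto simp: x_def)
  also have "\<dots> \<le> x * (L * (1 + 1 / m)) ^ m"
  proof (intro mult_left_mono power_mono)
    have "x \<le> L / m" using m unfolding L_def by (simp add: field_simps)
    then show "L + x \<le> L * (1 + 1 / m)" by (simp add: distrib_left)
  qed (use x L in auto)
  also have "\<dots> = x * L ^ m * (1 + 1 / m) ^ m" by (simp add: power_mult_distrib)
  also have "\<dots> \<le> x * L ^ m * 3"
  proof (rule mult_left_mono)
    show "(1 + 1 / real m) ^ m \<le> 3"
      using exp_ge_one_plus_x_over_n_power_n[of m 1] exp_le m by simp
  qed (use x L in simp)
  also have "L ^ m \<le> c m / x + (m * x) ^ m"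
  proof -
    have "L ^ m = c m / x \<or> L ^ m = (m * x) ^ m"
      unfolding L_def by (simp add: max_def root_pow)
    moreover have "0 \<le> c m / x" "0 \<le> (m * x) ^ m" using x nonneg by auto
    ultimately show ?thesis by linarith
  qed
  then have "x * L ^ m * 3 \<le> x * (c m / x + (m * x) ^ m) * 3"
    using x by simp
  also have "\<dots> = 3 * c m + 3 * x * (m * x) ^ m" using x by (simp add: field_simps)
  finally show ?thesis by (simp add: x_def)
qed

section \<open>Powers of partial frame operators\<close>

locale finite_frame =
  fixes A :: "'b set" and v :: "'a \<Rightarrow> 'b \<Rightarrow> real"
  assumes finite_A: "finite A"
begin

text \<open>
  Vectors are functions of which only the values on \<open>A\<close> count.
\<close>
definition dot :: "('b \<Rightarrow> real) \<Rightarrow> ('b \<Rightarrow> real) \<Rightarrow> real" where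
  "dot x y = (\<Sum>t\<in>A. x t * y t)"

definition frame_op :: "'a set \<Rightarrow> ('b \<Rightarrow> real) \<Rightarrow> ('b \<Rightarrow> real)" where
  "frame_op \<sigma> x = (\<lambda>t. \<Sum>j\<in>\<sigma>. dot (v j) x * v j t)"

definition power_form :: "'a set \<Rightarrow> nat \<Rightarrow> ('b \<Rightarrow> real) \<Rightarrow> ('b \<Rightarrow> real) \<Rightarrow> real" where
  "power_form \<sigma> k x y = dot ((frame_op \<sigma> ^^ k) x) y"

text \<open>
  This is the trace of the power of \<open>S\<^sub>\<sigma>\<close> with exponent \<open>k + 1\<close>, not \<open>k\<close>: one factor \<open>S\<^sub>\<sigma>\<close> is spent
  on the sum over \<open>\<sigma>\<close> (\<open>trace_form_eq_basis_trace\<close>).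
\<close>
definition trace_form :: "'a set \<Rightarrow> nat \<Rightarrow> real" where
  "trace_form \<sigma> k = (\<Sum>j\<in>\<sigma>. power_form \<sigma> k (v j) (v j))"

lemma dot_commute: "dot x y = dot y x"
  by (simp add: dot_def mult.commute)

lemma dot_self_nonneg: "0 \<le> dot x x"
  by (simp add: dot_def sum_nonneg)

lemma dot_unit: "s \<in> A \<Longrightarrow> dot x (\<lambda>t. if t = s then 1 else 0) = x s"
proof -
  have "dot x (\<lambda>t. if t = s then 1 else 0) = (\<Sum>t\<in>A. if t = s then x t else 0)"
    unfolding dot_def by (rule sum.cong) auto
  then show "s \<in> A \<Longrightarrow> ?thesis" using finite_A by simp
qed

lemma dot_sum_right: "dot x (\<lambda>t. \<Sum>j\<in>\<sigma>. c j * w j t) = (\<Sum>j\<in>\<sigma>. c j * dot x (w j))"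
  unfolding dot_def sum_distrib_left by (subst sum.swap) (simp add: mult_ac)

lemma dot_frame_op: "dot x (frame_op \<sigma> y) = (\<Sum>j\<in>\<sigma>. dot (v j) x * dot (v j) y)"
  unfolding frame_op_def dot_sum_right by (simp add: dot_commute mult_ac)

lemma frame_op_symmetric: "dot (frame_op \<sigma> x) y = dot x (frame_op \<sigma> y)"
  by (subst dot_commute) (simp add: dot_frame_op mult_ac)

lemma power_form_0: "power_form \<sigma> 0 x y = dot x y"
  by (simp add: power_form_def)

lemma power_form_Suc: "power_form \<sigma> (Suc k) x y = power_form \<sigma> k x (frame_op \<sigma> y)"
  by (simp add: power_form_def frame_op_symmetric)

lemma power_form_Suc_left: "power_form \<sigma> (Suc k) x y = power_form \<sigma> k (frame_op \<sigma> x) y"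
  unfolding power_form_def funpow_Suc_right by simp

lemma power_form_Suc_Suc:
  "power_form \<sigma> (Suc (Suc k)) x y = power_form \<sigma> k (frame_op \<sigma> x) (frame_op \<sigma> y)"
  by (simp only: power_form_Suc_left[of \<sigma> "Suc k"]) (rule power_form_Suc)

lemma power_form_sum_right:
  "power_form \<sigma> k x (\<lambda>t. \<Sum>j\<in>\<tau>. c j * w j t) = (\<Sum>j\<in>\<tau>. c j * power_form \<sigma> k x (w j))"
  unfolding power_form_def by (rule dot_sum_right)

text \<open>
  This replaces the square root of \<open>S\<^sub>\<sigma>\<^sup>k\<close>, and with it any spectral theory: for even \<open>k\<close> the form is
  \<open>\<langle>S\<^sup>a x, S\<^sup>a y\<rangle>\<close> with \<open>a = k/2\<close>, for odd \<open>k\<close> it is \<open>\<Sum>j\<in>\<sigma>. \<langle>v\<^sub>j, S\<^sup>a x\<rangle> \<langle>v\<^sub>j, S\<^sup>a y\<rangle>\<close>. Positivity,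
  log-convexity and trace inequalities below are read off from this representation.
\<close>
lemma power_form_gram:
  assumes "finite \<sigma>"
  shows "\<exists>(r::nat) f. \<forall>x y. power_form \<sigma> k x y = (\<Sum>i<r. dot (f i) x * dot (f i) y)"
proof (induction k rule: induct_nat_012)
  case 0
  obtain h where h: "bij_betw h {..<card A} A"
    using ex_bij_betw_nat_finite[OF finite_A] by (auto simp: lessThan_atLeast0)
  have "power_form \<sigma> 0 x y
      = (\<Sum>i<card A. dot (\<lambda>s. if s = h i then 1 else 0) x * dot (\<lambda>s. if s = h i then 1 else 0) y)"
    for x y
  proof -
    have "power_form \<sigma> 0 x y = (\<Sum>i<card A. x (h i) * y (h i))"
      unfolding power_form_0 dot_def using sum.reindex_bij_betw[OF h, of "\<lambda>t. x t * y t"] by simp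
    also have "\<dots> = (\<Sum>i<card A. dot (\<lambda>s. if s = h i then 1 else 0) x
        * dot (\<lambda>s. if s = h i then 1 else 0) y)"
      using bij_betwE[OF h] by (intro sum.cong) (auto simp: dot_unit dot_commute[of "\<lambda>s. if s = _ then 1 else 0"])
    finally show ?thesis .
  qed
  then show ?case by (intro exI allI)
next
  case 1
  obtain h where h: "bij_betw h {..<card \<sigma>} \<sigma>"
    using ex_bij_betw_nat_finite[OF assms] by (auto simp: lessThan_atLeast0)
  have "power_form \<sigma> (Suc 0) x y = (\<Sum>i<card \<sigma>. dot (v (h i)) x * dot (v (h i)) y)" for x y
    unfolding power_form_Suc power_form_0 dot_frame_op
    using sum.reindex_bij_betw[OF h, of "\<lambda>j. dot (v j) x * dot (v j) y"] by simp
  then show ?case by (intro exI allI)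
next
  case (ge2 k)
  then obtain r :: nat and f
    where f: "\<And>x y. power_form \<sigma> k x y = (\<Sum>i<r. dot (f i) x * dot (f i) y)" by blast
  have "power_form \<sigma> (Suc (Suc k)) x y
      = (\<Sum>i<r. dot (frame_op \<sigma> (f i)) x * dot (frame_op \<sigma> (f i)) y)" for x y
    unfolding power_form_Suc_Suc f frame_op_symmetric ..
  then show ?case by (intro exI allI)
qed

lemma power_form_commute:
  assumes "finite \<sigma>"
  shows "power_form \<sigma> k x y = power_form \<sigma> k y x"
  using power_form_gram[OF assms, of k] by (auto simp: mult.commute)

lemma power_form_self_nonneg:
  assumes "finite \<sigma>"
  shows "0 \<le> power_form \<sigma> k x x"
  using power_form_gram[OF assms, of k] by (fastforce intro: sum_nonneg)

lemma power_form_log_convex: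
  assumes "finite \<sigma>"
  shows "(power_form \<sigma> (Suc k) x x)\<^sup>2 \<le> power_form \<sigma> k x x * power_form \<sigma> (Suc (Suc k)) x x"
proof -
  obtain r :: nat and f
    where f: "\<And>x y. power_form \<sigma> k x y = (\<Sum>i<r. dot (f i) x * dot (f i) y)"
    using power_form_gram[OF assms, of k] by blast
  have "(power_form \<sigma> (Suc k) x x)\<^sup>2 = (\<Sum>i<r. dot (f i) x * dot (f i) (frame_op \<sigma> x))\<^sup>2"
    unfolding power_form_Suc f ..
  also have "\<dots> \<le> (\<Sum>i<r. (dot (f i) x)\<^sup>2) * (\<Sum>i<r. (dot (f i) (frame_op \<sigma> x))\<^sup>2)"
    by (rule Cauchy_Schwarz_ineq_sum)
  also have "\<dots> = power_form \<sigma> k x x * power_form \<sigma> (Suc (Suc k)) x x"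
    unfolding power_form_Suc_Suc f by (simp add: power2_eq_square)
  finally show ?thesis .
qed

text \<open>
  In matrix terms, the quadratic form of a positive semidefinite Gram matrix is at most the squared norm of the
  coefficients times the trace of the matrix.
\<close>
lemma power_form_sum_self_le:
  assumes "finite \<sigma>" "finite \<tau>"
  shows "power_form \<sigma> k (\<lambda>t. \<Sum>j\<in>\<tau>. c j * w j t) (\<lambda>t. \<Sum>j\<in>\<tau>. c j * w j t)
    \<le> (\<Sum>j\<in>\<tau>. (c j)\<^sup>2) * (\<Sum>j\<in>\<tau>. power_form \<sigma> k (w j) (w j))"
proof -
  obtain r :: nat and f
    where f: "\<And>x y. power_form \<sigma> k x y = (\<Sum>i<r. dot (f i) x * dot (f i) y)"
    using power_form_gram[OF assms(1), of k] by blast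
  have "power_form \<sigma> k (\<lambda>t. \<Sum>j\<in>\<tau>. c j * w j t) (\<lambda>t. \<Sum>j\<in>\<tau>. c j * w j t)
      = (\<Sum>i<r. (\<Sum>j\<in>\<tau>. c j * dot (f i) (w j))\<^sup>2)"
    by (simp add: f dot_sum_right power2_eq_square)
  also have "\<dots> \<le> (\<Sum>i<r. (\<Sum>j\<in>\<tau>. (c j)\<^sup>2) * (\<Sum>j\<in>\<tau>. (dot (f i) (w j))\<^sup>2))"
    by (intro sum_mono Cauchy_Schwarz_ineq_sum)
  also have "\<dots> = (\<Sum>j\<in>\<tau>. (c j)\<^sup>2) * (\<Sum>i<r. \<Sum>j\<in>\<tau>. (dot (f i) (w j))\<^sup>2)"
    by (simp add: sum_distrib_left)
  also have "(\<Sum>i<r. \<Sum>j\<in>\<tau>. (dot (f i) (w j))\<^sup>2) = (\<Sum>j\<in>\<tau>. power_form \<sigma> k (w j) (w j))"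
    by (subst sum.swap) (simp add: f power2_eq_square)
  finally show ?thesis .
qed

text \<open>
  Expand the power of \<open>S\<^sub>\<sigma> + v\<^sub>j v\<^sub>j\<^sup>T\<close> at the rank-one factor that is applied last; \<open>k\<close> counts the factors
  \<open>S\<^sub>\<sigma>\<close> that come after it.
\<close>
lemma power_form_insert:
  assumes "finite \<sigma>" "j \<notin> \<sigma>"
  shows "power_form (insert j \<sigma>) m x y = power_form \<sigma> m x y
    + (\<Sum>k<m. power_form \<sigma> k (v j) y * power_form (insert j \<sigma>) (m - Suc k) x (v j))"
proof (induction m arbitrary: y)
  case 0
  show ?case by (simp add: power_form_0)
next
  case (Suc m)
  let ?\<tau> = "insert j \<sigma>"
  have "dot z (frame_op ?\<tau> y) = dot z (frame_op \<sigma> y) + dot (v j) y * dot z (v j)" for z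
    unfolding dot_frame_op using assms by (simp add: dot_commute[of z "v j"])
  then have "power_form ?\<tau> (Suc m) x y
      = power_form ?\<tau> m x (frame_op \<sigma> y) + dot (v j) y * power_form ?\<tau> m x (v j)"
    unfolding power_form_Suc unfolding power_form_def by simp
  also have "\<dots> = power_form \<sigma> (Suc m) x y
      + (\<Sum>k<m. power_form \<sigma> (Suc k) (v j) y * power_form ?\<tau> (m - Suc k) x (v j))
      + power_form \<sigma> 0 (v j) y * power_form ?\<tau> m x (v j)"
    unfolding Suc.IH by (simp add: power_form_Suc power_form_0)
  also have "\<dots> = power_form \<sigma> (Suc m) x y
      + (\<Sum>k<Suc m. power_form \<sigma> k (v j) y * power_form ?\<tau> (Suc m - Suc k) x (v j))"
    by (subst sum.lessThan_Suc_shift) simp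
  finally show ?case .
qed

text \<open>
  Powers are not operator monotone, but on the perturbing vector itself every term of the expansion is nonnegative.
\<close>
lemma power_form_insert_mono:
  assumes "finite \<sigma>"
  shows "power_form \<sigma> m (v j) (v j) \<le> power_form (insert j \<sigma>) m (v j) (v j)"
proof (cases "j \<in> \<sigma>")
  case True
  then show ?thesis by (simp add: insert_absorb)
next
  case False
  show ?thesis
    unfolding power_form_insert[OF assms False, of m "v j" "v j"]
    using assms by (simp add: sum_nonneg power_form_self_nonneg)
qed

lemma power_form_insert_le:
  assumes "finite \<sigma>" "j \<notin> \<sigma>" "0 < m"
  shows "power_form (insert j \<sigma>) m (v j) (v j)
    \<le> 3 * power_form \<sigma> m (v j) (v j) + 3 * dot (v j) (v j) * (m * dot (v j) (v j)) ^ m"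
  using renewal_bound[of "\<lambda>k. power_form \<sigma> k (v j) (v j)"
      "\<lambda>k. power_form (insert j \<sigma>) k (v j) (v j)" m,
      OF power_form_self_nonneg power_form_log_convex power_form_insert] assms
  by (simp add: power_form_0)

lemma trace_form_nonneg: "finite \<sigma> \<Longrightarrow> 0 \<le> trace_form \<sigma> k"
  unfolding trace_form_def by (intro sum_nonneg power_form_self_nonneg)

lemma trace_form_eq_basis_trace:
  assumes "finite \<sigma>"
  shows "trace_form \<sigma> k
    = (\<Sum>s\<in>A. power_form \<sigma> (Suc k) (\<lambda>t. if t = s then 1 else 0) (\<lambda>t. if t = s then 1 else 0))"
proof -
  have "power_form \<sigma> (Suc k) (\<lambda>t. if t = s then 1 else 0) (\<lambda>t. if t = s then 1 else 0)
      = (\<Sum>j\<in>\<sigma>. v j s * (frame_op \<sigma> ^^ k) (v j) s)" if "s \<in> A" for s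
  proof -
    let ?e = "\<lambda>t. if t = s then 1 else (0::real)"
    have "power_form \<sigma> (Suc k) ?e ?e = power_form \<sigma> k ?e (\<lambda>t. \<Sum>j\<in>\<sigma>. dot (v j) ?e * v j t)"
      unfolding power_form_Suc frame_op_def ..
    also have "\<dots> = (\<Sum>j\<in>\<sigma>. dot (v j) ?e * power_form \<sigma> k ?e (v j))"
      by (rule power_form_sum_right)
    also have "\<dots> = (\<Sum>j\<in>\<sigma>. dot (v j) ?e * power_form \<sigma> k (v j) ?e)"
      by (simp add: power_form_commute[OF assms, of k ?e])
    also have "\<dots> = (\<Sum>j\<in>\<sigma>. v j s * (frame_op \<sigma> ^^ k) (v j) s)"
      by (simp add: power_form_def dot_unit that)
    finally show ?thesis .
  qed
  then have "(\<Sum>s\<in>A. power_form \<sigma> (Suc k) (\<lambda>t. if t = s then 1 else 0) (\<lambda>t. if t = s then 1 else 0))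
      = (\<Sum>s\<in>A. \<Sum>j\<in>\<sigma>. v j s * (frame_op \<sigma> ^^ k) (v j) s)" by simp
  also have "\<dots> = trace_form \<sigma> k"
    unfolding trace_form_def power_form_def dot_def
    by (subst sum.swap) (simp add: mult.commute)
  finally show ?thesis ..
qed

text \<open>
  Bessel's inequality says that \<open>\<Sum>j\<in>J. v\<^sub>j v\<^sub>j\<^sup>T\<close> is at most the identity; the sum on the left is the
  trace of its product with \<open>S\<^sub>\<sigma>\<^bsup>k+1\<^esup>\<close>. The Gram vectors of that power reduce the claim to Bessel's
  inequality for each of them.
\<close>
lemma sum_power_form_le_trace_form:
  assumes "finite \<sigma>" "finite J" and bessel: "\<And>x. (\<Sum>j\<in>J. (dot (v j) x)\<^sup>2) \<le> dot x x"
  shows "(\<Sum>j\<in>J. power_form \<sigma> (Suc k) (v j) (v j)) \<le> trace_form \<sigma> k"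
proof -
  obtain r :: nat and f
    where f: "\<And>x y. power_form \<sigma> (Suc k) x y = (\<Sum>i<r. dot (f i) x * dot (f i) y)"
    using power_form_gram[OF assms(1), of "Suc k"] by blast
  have "(\<Sum>j\<in>J. power_form \<sigma> (Suc k) (v j) (v j)) = (\<Sum>i<r. \<Sum>j\<in>J. (dot (v j) (f i))\<^sup>2)"
    by (subst sum.swap) (simp add: f power2_eq_square dot_commute)
  also have "\<dots> \<le> (\<Sum>i<r. dot (f i) (f i))" by (intro sum_mono bessel)
  also have "\<dots> = (\<Sum>s\<in>A. \<Sum>i<r. f i s * f i s)"
    unfolding dot_def by (rule sum.swap)
  also have "\<dots> = trace_form \<sigma> k"
    unfolding trace_form_eq_basis_trace[OF assms(1)] by (simp add: f dot_unit)
  finally show ?thesis .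
qed

text \<open>
  Cauchy--Schwarz gives \<open>\<langle>y, y\<rangle>\<^sup>2 \<le> \<langle>S\<^sub>\<sigma> y, y\<rangle>\<close>. By log-convexity all later ratios of the moments
  \<open>\<langle>S\<^sub>\<sigma>\<^sup>k y, y\<rangle>\<close> are then at least \<open>\<langle>y, y\<rangle>\<close> too, and the \<open>k\<close>-th moment is bounded by the trace because
  \<open>y\<close> is a combination of the \<open>v\<^sub>j\<close> with coefficients in the unit ball.
\<close>
lemma synthesis_power_le_trace_form:
  assumes "finite \<sigma>" and c: "(\<Sum>j\<in>\<sigma>. (c j)\<^sup>2) \<le> 1"
  defines "y \<equiv> (\<lambda>t. \<Sum>j\<in>\<sigma>. c j * v j t)"
  shows "dot y y ^ Suc k \<le> trace_form \<sigma> k"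
proof -
  have "(dot y y)\<^sup>2 = (\<Sum>j\<in>\<sigma>. c j * dot y (v j))\<^sup>2"
    by (subst (2) y_def) (simp only: dot_sum_right)
  also have "\<dots> \<le> (\<Sum>j\<in>\<sigma>. (c j)\<^sup>2) * (\<Sum>j\<in>\<sigma>. (dot y (v j))\<^sup>2)"
    by (rule Cauchy_Schwarz_ineq_sum)
  also have "\<dots> \<le> 1 * (\<Sum>j\<in>\<sigma>. (dot y (v j))\<^sup>2)"
    using c by (intro mult_right_mono sum_nonneg) auto
  also have "\<dots> = power_form \<sigma> (Suc 0) y y"
    by (simp add: power_form_Suc power_form_0 dot_frame_op power2_eq_square dot_commute)
  finally have start: "dot y y * power_form \<sigma> 0 y y \<le> power_form \<sigma> (Suc 0) y y"
    by (simp add: power2_eq_square power_form_0)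
  have "dot y y ^ Suc k = dot y y ^ k * power_form \<sigma> 0 y y" by (simp add: power_form_0)
  also have "\<dots> \<le> power_form \<sigma> (0 + k) y y"
    using start by (intro log_convex_ratio(2) power_form_self_nonneg power_form_log_convex
        dot_self_nonneg assms(1))
  also have "\<dots> \<le> (\<Sum>j\<in>\<sigma>. (c j)\<^sup>2) * trace_form \<sigma> k"
    unfolding y_def trace_form_def
    using power_form_sum_self_le[OF assms(1,1), of k c v] by simp
  also have "\<dots> \<le> 1 * trace_form \<sigma> k"
    using c trace_form_nonneg[OF assms(1)] by (intro mult_right_mono)
  finally show ?thesis by simp
qed

end

section \<open>Moments of a random partial frame operator\<close>

lemma finite_set_random_subset_pmf: "finite (set_pmf (random_subset_pmf N p))"
  by (rule finite_subset[of _ "Pow {..<N}"]) (auto simp: random_subset_pmf_def)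

lemma integrable_random_subset_pmf:
  fixes f :: "nat set \<Rightarrow> real"
  shows "integrable (random_subset_pmf N p) f"
  by (rule integrable_measure_pmf_finite[OF finite_set_random_subset_pmf])

lemma expectation_random_subset_mono:
  fixes f g :: "nat set \<Rightarrow> real"
  assumes "\<And>\<sigma>. \<sigma> \<subseteq> {..<N} \<Longrightarrow> f \<sigma> \<le> g \<sigma>"
  shows "measure_pmf.expectation (random_subset_pmf N p) f
    \<le> measure_pmf.expectation (random_subset_pmf N p) g"
proof (rule integral_mono_AE[OF integrable_random_subset_pmf integrable_random_subset_pmf])
  show "AE \<sigma> in random_subset_pmf N p. f \<sigma> \<le> g \<sigma>"
    by (auto simp: AE_measure_pmf_iff random_subset_pmf_def intro!: assms)
qed

text \<open>
  The event \<open>j \<in> \<sigma>\<close> has probability \<open>p\<close> and is independent of \<open>\<sigma> - {j}\<close>, of which \<open>F (insert j \<sigma>)\<close> is a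
  function.
\<close>
lemma expectation_random_subset_member:
  fixes F :: "nat set \<Rightarrow> real"
  assumes p: "0 \<le> p" "p \<le> 1" and j: "j < N"
  shows "measure_pmf.expectation (random_subset_pmf N p) (\<lambda>\<sigma>. if j \<in> \<sigma> then F \<sigma> else 0)
    = p * measure_pmf.expectation (random_subset_pmf N p) (\<lambda>\<sigma>. F (insert j \<sigma>))"
proof -
  define Q where "Q = Pi_pmf ({..<N} - {j}) False (\<lambda>_. bernoulli_pmf p)"
  define R where "R b f = {i \<in> {..<N}. (f(j := b)) i}" for b f
  have "random_subset_pmf N p = map_pmf (\<lambda>\<delta>. {i \<in> {..<N}. \<delta> i})
      (Pi_pmf (insert j ({..<N} - {j})) False (\<lambda>_. bernoulli_pmf p))"
    using j by (simp add: random_subset_pmf_def insert_absorb)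
  also have "\<dots> = bind_pmf (bernoulli_pmf p) (\<lambda>b. map_pmf (R b) Q)"
    by (subst Pi_pmf_insert')
      (auto simp: Q_def R_def map_bind_pmf map_pmf_def bind_assoc_pmf bind_return_pmf)
  finally have split: "random_subset_pmf N p = bind_pmf (bernoulli_pmf p) (\<lambda>b. map_pmf (R b) Q)" .
  have "finite (set_pmf (map_pmf (R b) Q))" for b
    by (rule finite_subset[of _ "Pow {..<N}"]) (auto simp: R_def)
  then have E: "measure_pmf.expectation (random_subset_pmf N p) h
      = p * measure_pmf.expectation Q (\<lambda>f. h (R True f))
        + (1 - p) * measure_pmf.expectation Q (\<lambda>f. h (R False f))" for h :: "nat set \<Rightarrow> real"
    unfolding split using p by (subst pmf_expectation_bind[of UNIV]) (auto simp: UNIV_bool)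
  have "insert j (R b f) = R True f" "j \<in> R True f" "j \<notin> R False f" for b f
    using j by (auto simp: R_def)
  then show ?thesis by (simp add: E algebra_simps)
qed

locale random_frame = finite_frame A v
  for A :: "'b set" and v :: "nat \<Rightarrow> 'b \<Rightarrow> real" +
  fixes N :: nat and p M :: real
  assumes p: "0 \<le> p" "p \<le> 1"
    and bessel: "\<And>x. (\<Sum>j<N. (dot (v j) x)\<^sup>2) \<le> dot x x"
    and norm_le: "\<And>j. j < N \<Longrightarrow> dot (v j) (v j) \<le> M\<^sup>2"
begin

abbreviation expec :: "(nat set \<Rightarrow> real) \<Rightarrow> real" where
  "expec \<equiv> measure_pmf.expectation (random_subset_pmf N p)"

lemma expec_trace_form:
  "expec (\<lambda>\<sigma>. trace_form \<sigma> m)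
    = (\<Sum>j<N. p * expec (\<lambda>\<sigma>. power_form (insert j \<sigma>) m (v j) (v j)))"
proof -
  have "trace_form \<sigma> m = (\<Sum>j<N. if j \<in> \<sigma> then power_form \<sigma> m (v j) (v j) else 0)"
    if "\<sigma> \<subseteq> {..<N}" for \<sigma>
    unfolding trace_form_def using that by (intro sum.mono_neutral_cong_left) auto
  then have "expec (\<lambda>\<sigma>. trace_form \<sigma> m)
      = expec (\<lambda>\<sigma>. \<Sum>j<N. if j \<in> \<sigma> then power_form \<sigma> m (v j) (v j) else 0)"
    by (intro antisym expectation_random_subset_mono) auto
  also have "\<dots> = (\<Sum>j<N. expec (\<lambda>\<sigma>. if j \<in> \<sigma> then power_form \<sigma> m (v j) (v j) else 0))"
    by (intro Bochner_Integration.integral_sum integrable_random_subset_pmf)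
  also have "\<dots> = (\<Sum>j<N. p * expec (\<lambda>\<sigma>. power_form (insert j \<sigma>) m (v j) (v j)))"
    using p by (intro sum.cong refl expectation_random_subset_member) auto
  finally show ?thesis .
qed

text \<open>
  The set \<open>\<sigma>\<close> may or may not contain \<open>j\<close>: the perturbation estimate is applied to \<open>\<sigma> - {j}\<close>, and
  monotonicity returns to \<open>\<sigma>\<close>, so that the right-hand side can be summed over all \<open>j\<close> for one and the same \<open>\<sigma>\<close>.
\<close>
lemma power_form_insert_le_power_form:
  assumes "finite \<sigma>" "j < N" "0 < m"
  shows "power_form (insert j \<sigma>) m (v j) (v j)
    \<le> 3 * power_form \<sigma> m (v j) (v j) + 3 * M\<^sup>2 * (m * M\<^sup>2) ^ m"
proof -
  let ?x = "dot (v j) (v j)"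
  have "power_form (insert j (\<sigma> - {j})) m (v j) (v j)
      \<le> 3 * power_form (\<sigma> - {j}) m (v j) (v j) + 3 * ?x * (m * ?x) ^ m"
    using assms by (intro power_form_insert_le) auto
  moreover have "power_form (\<sigma> - {j}) m (v j) (v j) \<le> power_form \<sigma> m (v j) (v j)"
    using power_form_insert_mono[of "\<sigma> - {j}" m j] assms(1)
    by (cases "j \<in> \<sigma>") (auto simp: insert_absorb)
  moreover have "3 * ?x * (m * ?x) ^ m \<le> 3 * M\<^sup>2 * (m * M\<^sup>2) ^ m"
    using norm_le[OF assms(2)] dot_self_nonneg[of "v j"]
    by (intro mult_mono power_mono mult_left_mono) auto
  ultimately show ?thesis by simp
qed

text \<open>
  The induction step from the trace of \<open>S\<^sub>\<sigma>\<^bsup>m+1\<^esup>\<close> to that of \<open>S\<^sub>\<sigma>\<^bsup>m+2\<^esup>\<close>: remove the condition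
  \<open>j \<in> \<sigma>\<close> at the price of \<open>p\<close>, absorb the rank-one perturbation, and sum over all \<open>j\<close> by Bessel's inequality.
\<close>
lemma expec_trace_form_Suc_le:
  "expec (\<lambda>\<sigma>. trace_form \<sigma> (Suc m)) \<le> 3 * p * expec (\<lambda>\<sigma>. trace_form \<sigma> m)
    + 3 * (real (Suc m) * M\<^sup>2) ^ Suc m * (p * N * M\<^sup>2)"
proof -
  let ?e = "3 * M\<^sup>2 * (real (Suc m) * M\<^sup>2) ^ Suc m"
  have "expec (\<lambda>\<sigma>. trace_form \<sigma> (Suc m))
      \<le> (\<Sum>j<N. p * (3 * expec (\<lambda>\<sigma>. power_form \<sigma> (Suc m) (v j) (v j)) + ?e))"
    unfolding expec_trace_form
  proof (intro sum_mono mult_left_mono p)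
    fix j assume j: "j \<in> {..<N}"
    have "expec (\<lambda>\<sigma>. power_form (insert j \<sigma>) (Suc m) (v j) (v j))
        \<le> expec (\<lambda>\<sigma>. 3 * power_form \<sigma> (Suc m) (v j) (v j) + ?e)"
      using j by (intro expectation_random_subset_mono power_form_insert_le_power_form)
        (auto dest: finite_subset[OF _ finite_lessThan])
    also have "\<dots> = 3 * expec (\<lambda>\<sigma>. power_form \<sigma> (Suc m) (v j) (v j)) + ?e"
      by (subst Bochner_Integration.integral_add) (auto intro: integrable_random_subset_pmf)
    finally show "expec (\<lambda>\<sigma>. power_form (insert j \<sigma>) (Suc m) (v j) (v j))
        \<le> 3 * expec (\<lambda>\<sigma>. power_form \<sigma> (Suc m) (v j) (v j)) + ?e" .
  qed
  also have "\<dots> = 3 * p * (\<Sum>j<N. expec (\<lambda>\<sigma>. power_form \<sigma> (Suc m) (v j) (v j))) + p * N * ?e"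
    by (simp add: sum_distrib_left sum.distrib algebra_simps del: power_Suc)
  also have "(\<Sum>j<N. expec (\<lambda>\<sigma>. power_form \<sigma> (Suc m) (v j) (v j)))
      = expec (\<lambda>\<sigma>. \<Sum>j<N. power_form \<sigma> (Suc m) (v j) (v j))"
    by (intro Bochner_Integration.integral_sum[symmetric] integrable_random_subset_pmf)
  also have "3 * p * \<dots> \<le> 3 * p * expec (\<lambda>\<sigma>. trace_form \<sigma> m)"
    using p bessel by (intro mult_left_mono expectation_random_subset_mono
        sum_power_form_le_trace_form) (auto dest: finite_subset[OF _ finite_lessThan])
  finally show ?thesis by (simp add: algebra_simps del: power_Suc)
qed

lemma expec_trace_form_0_le: "expec (\<lambda>\<sigma>. trace_form \<sigma> 0) \<le> p * N * M\<^sup>2"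
proof -
  have "expec (\<lambda>\<sigma>. trace_form \<sigma> 0) = (\<Sum>j<N. p * dot (v j) (v j))"
    by (simp add: expec_trace_form power_form_0)
  also have "\<dots> \<le> (\<Sum>j<N. p * M\<^sup>2)"
    using p by (intro sum_mono mult_left_mono norm_le) auto
  finally show ?thesis by (simp add: mult_ac)
qed

text \<open>
  Both coefficients of the recursion are absorbed by \<open>K = 3 (p + q M\<^sup>2)\<close>, as long as the exponent stays below
  \<open>q\<close>; each step then adds one more term \<open>p N K\<^bsup>m+1\<^esup>\<close>.
\<close>
lemma expec_trace_form_le:
  fixes q :: nat
  assumes "m < q"
  shows "expec (\<lambda>\<sigma>. trace_form \<sigma> m) \<le> Suc m * (p * N) * (3 * (p + q * M\<^sup>2)) ^ Suc m"
  using assms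
proof (induction m)
  case 0
  have "M\<^sup>2 \<le> q * M\<^sup>2" using 0 mult_right_mono[of 1 "real q" "M\<^sup>2"] by simp
  moreover have "y \<le> 3 * (p + z)" if "0 \<le> y" "y \<le> z" for y z using that p by simp
  ultimately have "M\<^sup>2 \<le> 3 * (p + q * M\<^sup>2)" by simp
  then have "p * N * M\<^sup>2 \<le> p * N * (3 * (p + q * M\<^sup>2))"
    using p by (intro mult_left_mono) auto
  then show ?case using expec_trace_form_0_le by simp
next
  case (Suc m)
  define K where "K = 3 * (p + q * M\<^sup>2)"
  have qM: "0 \<le> q * M\<^sup>2" by simp
  have K: "0 \<le> K" "3 * p \<le> K" "q * M\<^sup>2 \<le> K"
    using p qM by (simp_all add: K_def)
  have M: "3 * M\<^sup>2 \<le> K"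
  proof -
    have "M\<^sup>2 \<le> q * M\<^sup>2" using Suc.prems mult_right_mono[of 1 "real q" "M\<^sup>2"] by simp
    then show ?thesis using p by (simp add: K_def)
  qed
  have pN: "0 \<le> p * N" using p by simp
  have IH: "expec (\<lambda>\<sigma>. trace_form \<sigma> m) \<le> Suc m * (p * N) * K ^ Suc m"
    using Suc by (simp add: K_def)
  have "3 * p * expec (\<lambda>\<sigma>. trace_form \<sigma> m) \<le> 3 * p * (Suc m * (p * N) * K ^ Suc m)"
    using IH p by (intro mult_left_mono) auto
  also have "\<dots> \<le> K * (Suc m * (p * N) * K ^ Suc m)"
    using K p pN by (intro mult_right_mono) auto
  finally have 1: "3 * p * expec (\<lambda>\<sigma>. trace_form \<sigma> m) \<le> Suc m * (p * N) * K ^ Suc (Suc m)"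
    by (simp add: mult_ac)
  have "real (Suc m) * M\<^sup>2 \<le> q * M\<^sup>2"
    using Suc.prems by (intro mult_right_mono) auto
  then have "real (Suc m) * M\<^sup>2 \<le> K" using K by linarith
  then have "(real (Suc m) * M\<^sup>2) ^ Suc m * (3 * M\<^sup>2) \<le> K ^ Suc m * K"
    using M K by (intro mult_mono power_mono) auto
  then have "(p * N) * ((real (Suc m) * M\<^sup>2) ^ Suc m * (3 * M\<^sup>2)) \<le> (p * N) * (K ^ Suc m * K)"
    using pN by (intro mult_left_mono)
  then have 2: "3 * (real (Suc m) * M\<^sup>2) ^ Suc m * (p * N * M\<^sup>2) \<le> (p * N) * K ^ Suc (Suc m)"
    by (simp add: mult_ac)
  have "expec (\<lambda>\<sigma>. trace_form \<sigma> (Suc m)) \<le> (Suc m * (p * N) + p * N) * K ^ Suc (Suc m)"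
    using expec_trace_form_Suc_le[of m] 1 2 unfolding distrib_right by linarith
  also have "Suc m * (p * N) + p * N = Suc (Suc m) * (p * N)" by (simp add: algebra_simps)
  finally show ?case by (simp only: K_def)
qed

text \<open>
  The hypothesis on \<open>X\<close> is what \<open>r \<le> 1 + r\<^bsup>2q\<^esup>\<close> with \<open>r = X / s\<close> gives for a variable whose \<open>2q\<close>-th power is
  bounded by the trace. For \<open>s\<^sup>2 = 6 K\<close> the expected trace is at most \<open>s\<^bsup>2q\<^esup>\<close>: the factor \<open>6\<^sup>q\<close> pays for
  \<open>q \<le> 2\<^sup>q\<close> and \<open>p N \<le> 3\<^sup>q\<close>.
\<close>
lemma expec_le_of_moment:
  fixes q :: nat and X :: "nat set \<Rightarrow> real"
  assumes q: "0 < q" and p_pos: "0 < p" and "p * N \<le> 3 ^ q"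
    and X: "\<And>\<sigma> s. \<sigma> \<subseteq> {..<N} \<Longrightarrow> 0 < s \<Longrightarrow> X \<sigma> \<le> s + s * (trace_form \<sigma> (q - 1) / (s\<^sup>2) ^ q)"
  shows "expec X \<le> 2 * sqrt (18 * (p + q * M\<^sup>2))"
proof -
  define K where "K = 3 * (p + q * M\<^sup>2)"
  define s where "s = sqrt (6 * K)"
  have K: "0 < K" unfolding K_def using p_pos by (simp add: add_pos_nonneg)
  have s: "0 < s" "s\<^sup>2 = 6 * K" using K by (auto simp: s_def)
  have "expec (\<lambda>\<sigma>. trace_form \<sigma> (q - 1)) \<le> q * (p * N) * K ^ q"
    using expec_trace_form_le[of "q - 1" q] q by (simp add: K_def)
  also have "\<dots> \<le> 2 ^ q * 3 ^ q * K ^ q"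
  proof (intro mult_right_mono mult_mono)
    show "real q \<le> 2 ^ q" using of_nat_mono[of q "2 ^ q", where ?'a = real] less_exp[of q] by simp
  qed (use assms p K in auto)
  also have "\<dots> = (2 * 3 * K) ^ q" by (simp only: power_mult_distrib)
  also have "2 * 3 * K = s\<^sup>2" unfolding s(2) by simp
  finally have moment: "expec (\<lambda>\<sigma>. trace_form \<sigma> (q - 1)) \<le> (s\<^sup>2) ^ q" .
  have "expec X \<le> expec (\<lambda>\<sigma>. s + s * (trace_form \<sigma> (q - 1) / (s\<^sup>2) ^ q))"
    by (intro expectation_random_subset_mono X s)
  also have "\<dots> = s + s * (expec (\<lambda>\<sigma>. trace_form \<sigma> (q - 1)) / (s\<^sup>2) ^ q)"
    by (subst Bochner_Integration.integral_add) (auto intro: integrable_random_subset_pmf)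
  also have "\<dots> \<le> s + s * 1"
    using moment s(1) by (intro add_left_mono mult_left_mono) auto
  finally show ?thesis by (simp add: s_def K_def)
qed

end

section \<open>Linear operators on \<open>\<real>\<^sup>N\<close> and their matrix columns\<close>

text \<open>The symbol \<open>$\<close> denotes the entries of \<^typ>\<open>real vec\<close> only from here on.\<close>
unbundle no vec_syntax

lemma eucl_norm_eq: "eucl_norm x = sqrt (\<Sum>i<dim_vec x. (x $ i)\<^sup>2)"
  by (simp add: eucl_norm_def scalar_prod_def power2_eq_square lessThan_atLeast0)

lemma eucl_norm_smult: "eucl_norm (c \<cdot>\<^sub>v x) = \<bar>c\<bar> * eucl_norm x"
  by (simp add: eucl_norm_eq power_mult_distrib sum_distrib_left[symmetric] real_sqrt_mult)

lemma eucl_norm_nonneg: "0 \<le> eucl_norm x"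
  by (simp add: eucl_norm_eq sum_nonneg)

lemma coord_subspaceD:
  assumes "x \<in> coord_subspace N \<sigma>"
  shows "x \<in> carrier_vec N" and "i < N \<Longrightarrow> i \<notin> \<sigma> \<Longrightarrow> x $ i = 0"
proof -
  interpret vec_space "TYPE(real)" N .
  obtain a B where B: "x = lincomb a B" "B \<subseteq> unit_vec N ` \<sigma>"
    using assms unfolding coord_subspace_def span_def by auto
  show "x \<in> carrier_vec N"
    unfolding B(1) using B(2) by (intro lincomb_closed) auto
  assume i: "i < N" "i \<notin> \<sigma>"
  have "x $ i = (\<Sum>y\<in>B. a y * y $ i)"
    unfolding B(1) using i B(2) by (intro lincomb_index) auto
  also have "\<dots> = 0"
  proof (intro sum.neutral ballI)
    fix y assume "y \<in> B"
    then obtain l where "l \<in> \<sigma>" "y = unit_vec N l" using B(2) by auto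
    then have "y $ i = 0" using i by (auto simp: unit_vec_def)
    then show "a y * y $ i = 0" by simp
  qed
  finally show "x $ i = 0" .
qed

lemma zero_in_coord_subspace: "0\<^sub>v N \<in> coord_subspace N \<sigma>"
proof -
  interpret vec_space "TYPE(real)" N .
  have "lincomb a {} \<in> span (unit_vec N ` \<sigma>)" for a
    unfolding span_def by blast
  then show ?thesis
    unfolding coord_subspace_def by (simp add: lincomb_def)
qed

lemma op_norm_on_coord_subspace_le:
  assumes "\<And>x. x \<in> coord_subspace N \<sigma> \<Longrightarrow> eucl_norm x \<le> 1 \<Longrightarrow> eucl_norm (u x) \<le> b"
  shows "op_norm_on (coord_subspace N \<sigma>) u \<le> b"
  unfolding op_norm_on_def
proof (rule cSup_least)
  have "eucl_norm (0\<^sub>v N) \<le> 1" by (simp add: eucl_norm_eq)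
  then show "{eucl_norm (u x) |x. x \<in> coord_subspace N \<sigma> \<and> eucl_norm x \<le> 1} \<noteq> {}"
    using zero_in_coord_subspace by blast
qed (use assms in auto)

context
  fixes N :: nat and u :: "real vec \<Rightarrow> real vec"
  assumes u: "linear_map class_ring (ell2 N) (ell2 N) u"
begin

lemma operator_carrier: "x \<in> carrier_vec N \<Longrightarrow> u x \<in> carrier_vec N"
  and operator_add: "x \<in> carrier_vec N \<Longrightarrow> y \<in> carrier_vec N \<Longrightarrow> u (x + y) = u x + u y"
  and operator_smult: "x \<in> carrier_vec N \<Longrightarrow> u (c \<cdot>\<^sub>v x) = c \<cdot>\<^sub>v u x"
proof -
  interpret linear_map class_ring "ell2 N" "ell2 N" u by (rule u)
  show "x \<in> carrier_vec N \<Longrightarrow> u x \<in> carrier_vec N"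
    using f_im[of x] by (simp add: module_vec_simps)
  show "x \<in> carrier_vec N \<Longrightarrow> y \<in> carrier_vec N \<Longrightarrow> u (x + y) = u x + u y"
    using f_add[of x y] by (simp add: module_vec_simps)
  show "x \<in> carrier_vec N \<Longrightarrow> u (c \<cdot>\<^sub>v x) = c \<cdot>\<^sub>v u x"
    using f_smult[of c x] by (simp add: module_vec_simps class_ring_simps)
qed

lemma operator_column_expansion:
  assumes x: "x \<in> carrier_vec N" and t: "t < N"
  shows "u x $ t = (\<Sum>j<N. x $ j * u (unit_vec N j) $ t)"
proof -
  have "u (vec N (\<lambda>i. if i < k then x $ i else 0)) $ t = (\<Sum>j<k. x $ j * u (unit_vec N j) $ t)"
    if "k \<le> N" for k
    using that
  proof (induction k)
    case 0
    have "vec N (\<lambda>i. if i < 0 then x $ i else 0) = 0 \<cdot>\<^sub>v 0\<^sub>v N" by auto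
    then have "u (vec N (\<lambda>i. if i < 0 then x $ i else 0)) = 0 \<cdot>\<^sub>v u (0\<^sub>v N)"
      by (simp only: operator_smult zero_carrier_vec)
    moreover have "(0 \<cdot>\<^sub>v u (0\<^sub>v N)) $ t = 0"
      using operator_carrier[of "0\<^sub>v N"] t by simp
    ultimately show ?case by simp
  next
    case (Suc k)
    have dim: "dim_vec (u y) = N" if "y \<in> carrier_vec N" for y
      using operator_carrier[OF that] by simp
    have "vec N (\<lambda>i. if i < Suc k then x $ i else 0)
        = vec N (\<lambda>i. if i < k then x $ i else 0) + (x $ k) \<cdot>\<^sub>v unit_vec N k"
      using Suc.prems by (intro eq_vecI) (auto simp: unit_vec_def less_Suc_eq)
    then show ?case
      using Suc t by (simp add: operator_add operator_smult dim)
  qed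
  moreover have "vec N (\<lambda>i. if i < N then x $ i else 0) = x"
    using x by (intro eq_vecI) auto
  ultimately show ?thesis by (metis order_refl)
qed

text \<open>
  The operator norm is a supremum, which bounds its members only once the set is known to be bounded: the
  Frobenius norm of the matrix of \<open>u\<close> is an upper bound.
\<close>
lemma eucl_norm_image_le:
  assumes norm: "op_norm N u = 1" and x: "x \<in> carrier_vec N"
  shows "eucl_norm (u x) \<le> eucl_norm x"
proof -
  define B where "B = sqrt (\<Sum>t<N. \<Sum>j<N. (u (unit_vec N j) $ t)\<^sup>2)"
  have "eucl_norm (u y) \<le> B" if y: "y \<in> carrier_vec N" "eucl_norm y \<le> 1" for y
  proof -
    have y1: "(\<Sum>j<N. (y $ j)\<^sup>2) \<le> 1" using y by (simp add: eucl_norm_eq)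
    have "(u y $ t)\<^sup>2 \<le> (\<Sum>j<N. (u (unit_vec N j) $ t)\<^sup>2)" if "t < N" for t
    proof -
      have "(u y $ t)\<^sup>2 \<le> (\<Sum>j<N. (y $ j)\<^sup>2) * (\<Sum>j<N. (u (unit_vec N j) $ t)\<^sup>2)"
        unfolding operator_column_expansion[OF y(1) that] by (rule Cauchy_Schwarz_ineq_sum)
      also have "\<dots> \<le> 1 * (\<Sum>j<N. (u (unit_vec N j) $ t)\<^sup>2)"
        using y1 by (intro mult_right_mono sum_nonneg) auto
      finally show ?thesis by simp
    qed
    then show ?thesis
      using operator_carrier[OF y(1)] by (auto simp: B_def eucl_norm_eq intro!: sum_mono)
  qed
  then have bdd: "bdd_above {eucl_norm (u y) |y. y \<in> carrier_vec N \<and> eucl_norm y \<le> 1}"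
    by (intro bdd_aboveI[of _ B]) auto
  have unit: "eucl_norm (u y) \<le> 1" if "y \<in> carrier_vec N" "eucl_norm y \<le> 1" for y
    using cSup_upper[OF _ bdd, of "eucl_norm (u y)"] that norm unfolding op_norm_on_def by auto
  show ?thesis
  proof (cases "eucl_norm x = 0")
    case True
    then have "(\<Sum>j<N. (x $ j)\<^sup>2) = 0" using x by (simp add: eucl_norm_eq)
    then have "x $ j = 0" if "j < N" for j
      using that by (simp add: sum_nonneg_eq_0_iff)
    then have "u x $ t = 0" if "t < N" for t
      using operator_column_expansion[OF x that] by simp
    then have "eucl_norm (u x) = 0"
      using operator_carrier[OF x] by (simp add: eucl_norm_eq)
    then show ?thesis using True by simp
  next
    case False
    then have pos: "0 < eucl_norm x" using eucl_norm_nonneg[of x] by linarith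
    have "eucl_norm (u ((1 / eucl_norm x) \<cdot>\<^sub>v x)) \<le> 1"
      using x pos by (intro unit) (auto simp: eucl_norm_smult)
    then show ?thesis using pos x by (simp add: operator_smult eucl_norm_smult field_simps)
  qed
qed

text \<open>
  The vector \<open>z\<close> of the inner products is \<open>u\<^sup>T w\<close>, and \<open>\<parallel>z\<parallel>\<^sup>2 = \<langle>w, u z\<rangle> \<le> \<parallel>w\<parallel> \<parallel>u z\<parallel> \<le> \<parallel>w\<parallel> \<parallel>z\<parallel>\<close>.
\<close>
lemma column_bessel:
  fixes w :: "nat \<Rightarrow> real"
  assumes norm: "op_norm N u = 1"
  shows "(\<Sum>j<N. (\<Sum>t<N. u (unit_vec N j) $ t * w t)\<^sup>2) \<le> (\<Sum>t<N. w t * w t)"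
proof -
  define z where "z = vec N (\<lambda>j. \<Sum>t<N. u (unit_vec N j) $ t * w t)"
  define Z where "Z = (\<Sum>j<N. (z $ j)\<^sup>2)"
  have z: "z \<in> carrier_vec N" by (simp add: z_def)
  \<comment> \<open>\<open>Z = \<langle>w, u z\<rangle>\<close>\<close>
  have "Z = (\<Sum>j<N. \<Sum>t<N. w t * (z $ j * u (unit_vec N j) $ t))"
    unfolding Z_def
    by (intro sum.cong refl) (simp add: z_def power2_eq_square sum_distrib_left mult_ac)
  also have "\<dots> = (\<Sum>t<N. w t * u z $ t)"
    by (subst sum.swap) (simp add: operator_column_expansion[OF z] sum_distrib_left)
  finally have "Z\<^sup>2 \<le> (\<Sum>t<N. (w t)\<^sup>2) * (\<Sum>t<N. (u z $ t)\<^sup>2)"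
    by (simp only: Cauchy_Schwarz_ineq_sum)
  also have "(\<Sum>t<N. (u z $ t)\<^sup>2) \<le> Z"
    using eucl_norm_image_le[OF norm z] z operator_carrier[OF z] by (simp add: eucl_norm_eq Z_def)
  then have "(\<Sum>t<N. (w t)\<^sup>2) * (\<Sum>t<N. (u z $ t)\<^sup>2) \<le> (\<Sum>t<N. (w t)\<^sup>2) * Z"
    by (intro mult_left_mono sum_nonneg) auto
  finally have ZZ: "Z * Z \<le> (\<Sum>t<N. (w t)\<^sup>2) * Z" by (simp add: power2_eq_square)
  have "0 \<le> Z" by (simp add: Z_def sum_nonneg)
  then have "Z \<le> (\<Sum>t<N. (w t)\<^sup>2)"
  proof (cases "Z = 0")
    case True
    then show ?thesis by (simp add: sum_nonneg)
  qed (use ZZ in auto)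
  then show ?thesis by (simp add: Z_def z_def power2_eq_square)
qed

end

theorem theorem2p2:
  shows "\<exists>C::real. C > 0 \<and>
    (\<forall>(N::nat) (n::nat) (u :: real vec \<Rightarrow> real vec) (M::real).
       linear_map class_ring (ell2 N) (ell2 N) u \<longrightarrow>
       op_norm N u = 1 \<longrightarrow>
       M = Max ((\<lambda>j. eucl_norm (u (unit_vec N j))) ` {..<N}) \<longrightarrow>
       1 < n \<longrightarrow> n \<le> N \<longrightarrow>
       measure_pmf.expectation (random_subset_pmf N (real n / real N))
           (\<lambda>\<sigma>. op_norm_on (coord_subspace N \<sigma>) u)
         \<le> C * sqrt (ln (real n)) * (sqrt (real n / real N) + sqrt (ln (real n)) * M))"
proof (intro exI conjI allI impI)
  show "(27::real) > 0" by simp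
  fix N n :: nat and u :: "real vec \<Rightarrow> real vec" and M :: real
  assume u: "linear_map class_ring (ell2 N) (ell2 N) u" and norm: "op_norm N u = 1"
    and M: "M = Max ((\<lambda>j. eucl_norm (u (unit_vec N j))) ` {..<N})" and n: "1 < n" "n \<le> N"
  define p where "p = real n / real N"
  define v where "v j t = u (unit_vec N j) $ t" for j t
  \<comment> \<open>the least exponent with \<open>n \<le> e\<^sup>q\<close>\<close>
  define q where "q = nat \<lceil>ln (real n)\<rceil>"
  have prob: "0 < p" "p \<le> 1" "p * N = n" using n by (auto simp: p_def)
  interpret fr: finite_frame "{..<N}" v by unfold_locales simp
  have dot_eq: "fr.dot x x = (\<Sum>t<N. (x t)\<^sup>2)" for x
    by (simp add: fr.dot_def power2_eq_square)
  have column_le: "eucl_norm (u (unit_vec N j)) \<le> M" if "j < N" for j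
    unfolding M using that by (intro Max_ge) auto
  have M_nonneg: "0 \<le> M"
    using column_le[of 0] n order_trans[OF eucl_norm_nonneg] by simp
  interpret random_frame "{..<N}" v N p M
  proof
    show "0 \<le> p" "p \<le> 1" using prob by auto
    show "(\<Sum>j<N. (fr.dot (v j) x)\<^sup>2) \<le> fr.dot x x" for x
      unfolding fr.dot_def v_def by (rule column_bessel[OF u norm])
    show "fr.dot (v j) (v j) \<le> M\<^sup>2" if "j < N" for j
    proof -
      have "fr.dot (v j) (v j) = (eucl_norm (u (unit_vec N j)))\<^sup>2"
        using operator_carrier[OF u unit_vec_carrier, of j]
        by (simp add: dot_eq eucl_norm_eq v_def sum_nonneg)
      also have "\<dots> \<le> M\<^sup>2" using column_le[OF that] eucl_norm_nonneg by (rule power_mono)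
      finally show ?thesis .
    qed
  qed

  have ln_n: "2 / 3 \<le> ln (real n)"
    using n ln2_ge_two_thirds ln_mono[of 2 "real n"] by linarith
  have q: "ln (real n) \<le> q" "q \<le> 4 * ln (real n)" "0 < q"
    using ln_n unfolding q_def by linarith+
  have "real n = exp (ln (real n))" using n by simp
  also have "\<dots> \<le> exp (real q)" using q by simp
  also have "\<dots> = exp 1 ^ q" by (simp add: exp_of_nat_mult[symmetric])
  also have "\<dots> \<le> 3 ^ q" using exp_le by (intro power_mono) auto
  finally have n_le: "p * N \<le> 3 ^ q" using prob by simp

  have "op_norm_on (coord_subspace N \<sigma>) u \<le> s + s * (fr.trace_form \<sigma> (q - 1) / (s\<^sup>2) ^ q)"
    if \<sigma>: "\<sigma> \<subseteq> {..<N}" and s: "0 < s" for \<sigma> s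
  proof (rule op_norm_on_coord_subspace_le)
    fix x assume x: "x \<in> coord_subspace N \<sigma>" and x1: "eucl_norm x \<le> 1"
    define y where "y = (\<lambda>t. \<Sum>j\<in>\<sigma>. x $ j * v j t)"
    have carrier: "x \<in> carrier_vec N" using x by (rule coord_subspaceD)
    have fin: "finite \<sigma>" using \<sigma> by (rule finite_subset) simp
    have "u x $ t = y t" if "t < N" for t
      unfolding operator_column_expansion[OF u carrier that] y_def v_def
      using \<sigma> coord_subspaceD(2)[OF x] by (intro sum.mono_neutral_right) auto
    then have ux: "(eucl_norm (u x))\<^sup>2 = fr.dot y y"
      using operator_carrier[OF u carrier] by (simp add: dot_eq eucl_norm_eq sum_nonneg)
    have "(\<Sum>j\<in>\<sigma>. (x $ j)\<^sup>2) \<le> (\<Sum>j<N. (x $ j)\<^sup>2)"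
      using \<sigma> by (intro sum_mono2) auto
    also have "\<dots> \<le> 1" using x1 carrier by (simp add: eucl_norm_eq)
    finally have "fr.dot y y ^ Suc (q - 1) \<le> fr.trace_form \<sigma> (q - 1)"
      unfolding y_def by (rule fr.synthesis_power_le_trace_form[OF fin])
    then have trace: "((eucl_norm (u x))\<^sup>2) ^ q \<le> fr.trace_form \<sigma> (q - 1)"
      using q by (simp add: ux)
    define r where "r = eucl_norm (u x) / s"
    have r: "0 \<le> r" using s by (simp add: r_def eucl_norm_nonneg)
    have "r \<le> 1 + r ^ (2 * q)"
    proof (cases "r \<le> 1")
      case True
      then show ?thesis using r by (simp add: add_increasing2)
    next
      case False
      then show ?thesis using self_le_power[of r "2 * q"] q by simp
    qed
    also have "r ^ (2 * q) = ((eucl_norm (u x))\<^sup>2) ^ q / (s\<^sup>2) ^ q"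
      by (simp add: r_def power_divide power_mult)
    also have "\<dots> \<le> fr.trace_form \<sigma> (q - 1) / (s\<^sup>2) ^ q"
      using trace by (intro divide_right_mono) auto
    finally have "r \<le> 1 + fr.trace_form \<sigma> (q - 1) / (s\<^sup>2) ^ q" by simp
    then have "s * r \<le> s * (1 + fr.trace_form \<sigma> (q - 1) / (s\<^sup>2) ^ q)"
      using s by (intro mult_left_mono) auto
    then show "eucl_norm (u x) \<le> s + s * (fr.trace_form \<sigma> (q - 1) / (s\<^sup>2) ^ q)"
      using s by (simp add: r_def distrib_left)
  qed
  then have "expec (\<lambda>\<sigma>. op_norm_on (coord_subspace N \<sigma>) u) \<le> 2 * sqrt (18 * (p + q * M\<^sup>2))"
    by (rule expec_le_of_moment[OF q(3) prob(1) n_le])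
  also have "\<dots> \<le> 2 * (sqrt 18 * (sqrt p + sqrt q * M))"
  proof -
    have "sqrt (p + q * M\<^sup>2) \<le> sqrt p + sqrt (q * M\<^sup>2)"
      using prob by (intro sqrt_add_le_add_sqrt) auto
    also have "sqrt (q * M\<^sup>2) = sqrt q * M" using M_nonneg by (simp add: real_sqrt_mult)
    finally have "2 * (sqrt 18 * sqrt (p + q * M\<^sup>2)) \<le> 2 * (sqrt 18 * (sqrt p + sqrt q * M))"
      by (intro mult_left_mono) auto
    then show ?thesis by (simp only: real_sqrt_mult)
  qed
  also have "\<dots> \<le> 27 * sqrt (ln n) * (sqrt p + sqrt (ln n) * M)"
  proof -
    let ?l = "sqrt (ln n)"
    \<comment> \<open>Since \<open>n \<ge> 2\<close>, \<open>ln n\<close> is bounded away from \<open>0\<close>, so a factor \<open>sqrt (ln n)\<close> can be added to both terms; the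
        constants multiply to \<open>2 * 9/2 * 3 = 27\<close>.\<close>
    have sqrt18: "sqrt 18 \<le> 9 / 2" by (rule real_le_lsqrt) (auto simp: power2_eq_square)
    have l: "2 / 3 \<le> ?l"
      using ln_n by (intro real_le_rsqrt) (simp add: power2_eq_square)
    have "sqrt q \<le> sqrt (4 * ln n)" using q by simp
    then have "sqrt q \<le> 2 * ?l" by (simp add: real_sqrt_mult)
    also have "\<dots> \<le> 3 * ?l * ?l" using l ln_n by (intro mult_right_mono) auto
    finally have "sqrt q * M \<le> 3 * ?l * ?l * M"
      using M_nonneg by (rule mult_right_mono)
    moreover have "1 * sqrt p \<le> 3 * ?l * sqrt p"
      using l prob by (intro mult_right_mono) auto
    ultimately have sum_le: "sqrt p + sqrt q * M \<le> 3 * ?l * (sqrt p + ?l * M)"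
      by (simp add: algebra_simps)
    have "sqrt 18 * (sqrt p + sqrt q * M) \<le> 9 / 2 * (3 * ?l * (sqrt p + ?l * M))"
      using sqrt18 sum_le prob M_nonneg by (intro mult_mono) auto
    moreover have "2 * (9 / 2 * (3 * a * b)) = 27 * a * b" for a b :: real by simp
    ultimately show ?thesis by (metis mult_left_mono zero_le_numeral)
  qed
  finally show "measure_pmf.expectation (random_subset_pmf N (real n / real N))
           (\<lambda>\<sigma>. op_norm_on (coord_subspace N \<sigma>) u)
         \<le> 27 * sqrt (ln (real n)) * (sqrt (real n / real N) + sqrt (ln (real n)) * M)"
    by (simp add: p_def)
qed

end
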